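(* Let $M$ be a finite set, let $(\lambda,\mathcal{L})$ be a ranked lattice of subsets of $M$ and let $\mu$ be a measure on $M$. Suppose that - $\lambda(O_{\mathcal{L}})=0$; - for all $Z_1,Z_2\in\mathcal{L}$ with $Z_1\subsetneq Z_2$: $0<\lambda(Z_2)-\lambda(Z_1)<\mu(Z_2\setminus Z_1)$; - for all $Z_1,Z_2\in\mathcal{L}$: $\lambda(Z_1)+\lambda(Z_2)\ge \lambda(Z_1\lor Z_2)+\lambda(Z_1\land Z_2)+\mu\big((Z_1\cap Z_2)\setminus(Z_1\land Z_2)\big)$; - if $a\in Z\in\mathcal{L}$, then $\mu(\{a\})\le\lambda(Z)$; - $\lambda(Z)>0$ for every $Z\in\mathcal{L}$ with $Z\ne O_{\mathcal{L}}$, and $\mu(\{a\})>0$ for every $a\in M\setminus O_{\mathcal{L}}$. Then the convolution $r=\lambda*\mu$ is the rank function of a polymatroid $(r,M)$ such that $\mathcal{L}$ is exactly the collection of cyclic flats of $(r,M)$, $r(Z)=\lambda(Z)$ for every $Z\in\mathcal{L}$, and $r(\{a\})=\mu(\{a\})$ for every $a\in M$.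
   Context: All sets are finite. A polymatroid $(f,M)$ is a non-negative, monotone, submodular real function $f$ on the subsets of $M$. A subset $F\subseteq M$ is a flat if $f(F')>f(F)$ for every $F'$ with $F\subsetneq F'\subseteq M$. A flat $C$ is cyclic if for every $i\in C$ either $f(\{i\})=0$ or $f(C)-f(C\setminus\{i\})<f(\{i\})$. A measure on $M$ is a non-negative additive function $\mu$ on the subsets of $M$, i.e. $\mu(A)=\sum_{a\in A}\mu(\{a\})$ with $\mu(\{a\})\ge 0$. A lattice $\mathcal{L}$ of subsets of $M$ is a non-empty collection of subsets of $M$ which is a lattice under the inclusion order: any $Z_1,Z_2\in\mathcal{L}$ have in $\mathcal{L}$ a least upper bound $Z_1\lor Z_2$ and a greatest lower bound $Z_1\land Z_2$ (these need not be the union and the intersection). Its smallest element is denoted $O_{\mathcal{L}}$. A ranked lattice $(\lambda,\mathcal{L})$ is such a lattice with a function $\lambda:\mathcal{L}\to\mathbb{R}_{\ge0}$. The convolution $\lambda*\mu$ is the function on subsets of $M$ given by $(\lambda*\mu)(A)=\min\{\lambda(Z)+\mu(A\setminus Z): Z\in\mathcal{L}\}$. *)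

theory Defs
  imports Complex_Main "HOL-Algebra.Lattice"
begin

definition polymatroid :: "('a set \<Rightarrow> real) \<Rightarrow> 'a set \<Rightarrow> bool" where
  "polymatroid f M \<longleftrightarrow>
     finite M \<and>
     (\<forall>A\<subseteq>M. 0 \<le> f A) \<and>
     (\<forall>A B. A \<subseteq> B \<and> B \<subseteq> M \<longrightarrow> f A \<le> f B) \<and>
     (\<forall>A\<subseteq>M. \<forall>B\<subseteq>M. f (A \<union> B) + f (A \<inter> B) \<le> f A + f B)"

definition flat :: "('a set \<Rightarrow> real) \<Rightarrow> 'a set \<Rightarrow> 'a set \<Rightarrow> bool" where
  "flat f M F \<longleftrightarrow> F \<subseteq> M \<and> (\<forall>F'. F \<subset> F' \<and> F' \<subseteq> M \<longrightarrow> f F' > f F)"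

definition cyclic_flat :: "('a set \<Rightarrow> real) \<Rightarrow> 'a set \<Rightarrow> 'a set \<Rightarrow> bool" where
  "cyclic_flat f M C \<longleftrightarrow>
     flat f M C \<and> (\<forall>i\<in>C. f {i} = 0 \<or> f C - f (C - {i}) < f {i})"

definition measure_on :: "('a set \<Rightarrow> real) \<Rightarrow> 'a set \<Rightarrow> bool" where
  "measure_on \<mu> M \<longleftrightarrow> (\<forall>a\<in>M. 0 \<le> \<mu> {a}) \<and> (\<forall>A\<subseteq>M. \<mu> A = (\<Sum>a\<in>A. \<mu> {a}))"

abbreviation inclusion_order :: "'a set set \<Rightarrow> 'a set gorder" where
  "inclusion_order \<L> \<equiv> \<lparr>carrier = \<L>, eq = (=), le = (\<subseteq>)\<rparr>"

text \<open>The values of \<open>lam\<close> outside \<open>\<L>\<close> are irrelevant: the rank is a function on \<open>\<L>\<close> only.\<close>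

definition ranked_lattice :: "('a set \<Rightarrow> real) \<Rightarrow> 'a set set \<Rightarrow> 'a set \<Rightarrow> bool" where
  "ranked_lattice lam \<L> M \<longleftrightarrow>
     \<L> \<noteq> {} \<and> \<L> \<subseteq> Pow M \<and> lattice (inclusion_order \<L>) \<and> (\<forall>Z\<in>\<L>. 0 \<le> lam Z)"

definition convolution ::
    "('a set \<Rightarrow> real) \<Rightarrow> 'a set set \<Rightarrow> ('a set \<Rightarrow> real) \<Rightarrow> 'a set \<Rightarrow> real" where
  "convolution lam \<L> \<mu> A = Min {lam Z + \<mu> (A - Z) | Z. Z \<in> \<L>}"

end

(* Nonnegativity and monotonicity of the convolution are immediate. For submodularity, combine
   minimizers Z1 of A and Z2 of B by the inequality for lam: their join serves A \<union> B, their meet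
   serves A \<inter> B, and the measure term pays for the elements of Z1 \<inter> Z2 lost in the meet.
   The strict bounds on lam make Z the unique minimizer for Z in the lattice, which gives r Z = lam Z
   and that Z is a cyclic flat. Conversely, for a cyclic flat C with minimizer Y, flatness gives
   Y \<subseteq> C, and an element of C - Y would contribute its full rank to C. *)

theory Submission
  imports Defs
begin

text \<open>Join and meet are replaced in \<open>lam_submod\<close> by some member \<open>J\<close>
  above the union and some member \<open>W\<close> below the intersection, so that the argument runs
  on plain sets instead of order structures.\<close>

locale lattice_convolution =
  fixes M bot :: "'a set" and \<L> :: "'a set set" and lam \<mu> :: "'a set \<Rightarrow> real"
  assumes finite_ground: "finite M"
    and lattice_sub: "Z \<in> \<L> \<Longrightarrow> Z \<subseteq> M"
    and lam_nonneg: "Z \<in> \<L> \<Longrightarrow> 0 \<le> lam Z"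
    and measure: "measure_on \<mu> M"
    and bot_in: "bot \<in> \<L>"
    and bot_sub: "Z \<in> \<L> \<Longrightarrow> bot \<subseteq> Z"
    and lam_bot: "lam bot = 0"
    and lam_strict: "Z1 \<in> \<L> \<Longrightarrow> Z2 \<in> \<L> \<Longrightarrow> Z1 \<subset> Z2 \<Longrightarrow>
           lam Z1 < lam Z2 \<and> lam Z2 - lam Z1 < \<mu> (Z2 - Z1)"
    and lam_submod: "Z1 \<in> \<L> \<Longrightarrow> Z2 \<in> \<L> \<Longrightarrow> \<exists>J\<in>\<L>. \<exists>W\<in>\<L>. Z1 \<union> Z2 \<subseteq> J \<and> W \<subseteq> Z1 \<inter> Z2 \<and>
           lam J + lam W + \<mu> (Z1 \<inter> Z2 - W) \<le> lam Z1 + lam Z2"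
    and measure_le_lam: "a \<in> Z \<Longrightarrow> Z \<in> \<L> \<Longrightarrow> \<mu> {a} \<le> lam Z"
    and measure_pos: "a \<in> M - bot \<Longrightarrow> 0 < \<mu> {a}"
begin

abbreviation r :: "'a set \<Rightarrow> real" where
  "r \<equiv> convolution lam \<L> \<mu>"

section \<open>Measures as weighted counts\<close>

lemma singleton_nonneg: "a \<in> M \<Longrightarrow> 0 \<le> \<mu> {a}"
  using measure unfolding measure_on_def by blast

text \<open>Summing over all of \<open>M\<close> with indicator weights gives all measures a common
  index set, so that identities and inequalities between them can be checked element by
  element.\<close>

lemma measure_eq_sum:
  assumes "A \<subseteq> M"
  shows "\<mu> A = (\<Sum>a\<in>M. if a \<in> A then \<mu> {a} else 0)"
proof -
  have "\<mu> A = (\<Sum>a\<in>A. \<mu> {a})"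
    using measure assms unfolding measure_on_def by blast
  also have "\<dots> = (\<Sum>a\<in>M. if a \<in> A then \<mu> {a} else 0)"
    using finite_ground assms by (simp add: sum.If_cases Int_absorb1)
  finally show ?thesis .
qed

lemma measure_union:
  assumes "A \<subseteq> M" "B \<subseteq> M" "A \<inter> B = {}"
  shows "\<mu> (A \<union> B) = \<mu> A + \<mu> B"
proof -
  have AB: "A \<union> B \<subseteq> M" using assms by blast
  show ?thesis
    unfolding measure_eq_sum[OF AB] measure_eq_sum[OF assms(1)]
      measure_eq_sum[OF assms(2)] sum.distrib[symmetric]
    using assms(3) by (intro sum.cong) auto
qed

lemma measure_mono:
  assumes "A \<subseteq> B" "B \<subseteq> M"
  shows "\<mu> A \<le> \<mu> B"
  unfolding measure_eq_sum[OF order_trans[OF assms]] measure_eq_sum[OF assms(2)]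
  using assms(1) singleton_nonneg by (intro sum_mono) auto

lemma measure_empty [simp]: "\<mu> {} = 0"
  using measure_eq_sum[of "{}"] by simp

lemma measure_nonneg: "A \<subseteq> M \<Longrightarrow> 0 \<le> \<mu> A"
  using measure_mono[of "{}" A] by simp

lemma measure_ge_singleton:
  assumes "A \<subseteq> M" "a \<in> A"
  shows "\<mu> {a} \<le> \<mu> A"
  using assms by (intro measure_mono) auto

lemma measure_remove:
  assumes "A \<subseteq> M" "a \<in> A"
  shows "\<mu> (A - {a}) = \<mu> A - \<mu> {a}"
  using measure_union[of "A - {a}" "{a}"] assms by (simp add: insert_absorb Diff_subset subset_iff)

section \<open>The convolution as a polymatroid\<close>

lemma finite_lattice: "finite \<L>"
  using finite_ground lattice_sub by (auto intro: finite_subset[of \<L> "Pow M"])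

lemma r_le: "Z \<in> \<L> \<Longrightarrow> r A \<le> lam Z + \<mu> (A - Z)"
  unfolding convolution_def using finite_lattice by (intro Min_le) auto

lemma r_attained:
  obtains Z where "Z \<in> \<L>" "r A = lam Z + \<mu> (A - Z)"
proof -
  let ?S = "{lam Z + \<mu> (A - Z) | Z. Z \<in> \<L>}"
  have "Min ?S \<in> ?S"
    using finite_lattice bot_in by (intro Min_in) auto
  then show thesis
    using that unfolding convolution_def by blast
qed

lemma r_nonneg:
  assumes "A \<subseteq> M"
  shows "0 \<le> r A"
proof -
  obtain Z where "Z \<in> \<L>" "r A = lam Z + \<mu> (A - Z)" by (rule r_attained)
  moreover have "0 \<le> \<mu> (A - Z)"
    using assms by (intro measure_nonneg) blast
  ultimately show ?thesis
    using lam_nonneg[of Z] by simp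
qed

lemma r_mono:
  assumes "A \<subseteq> B" "B \<subseteq> M"
  shows "r A \<le> r B"
proof -
  obtain Z where "Z \<in> \<L>" "r B = lam Z + \<mu> (B - Z)" by (rule r_attained)
  moreover have "\<mu> (A - Z) \<le> \<mu> (B - Z)"
    using assms by (intro measure_mono) auto
  ultimately show ?thesis
    using r_le[of Z A] by simp
qed

lemma r_submodular:
  assumes "A \<subseteq> M" "B \<subseteq> M"
  shows "r (A \<union> B) + r (A \<inter> B) \<le> r A + r B"
proof -
  obtain Y where Y: "Y \<in> \<L>" "r A = lam Y + \<mu> (A - Y)" by (rule r_attained)
  obtain Z where Z: "Z \<in> \<L>" "r B = lam Z + \<mu> (B - Z)" by (rule r_attained)
  obtain J W where JW: "J \<in> \<L>" "W \<in> \<L>" "Y \<union> Z \<subseteq> J" "W \<subseteq> Y \<inter> Z"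
      and submod: "lam J + lam W + \<mu> (Y \<inter> Z - W) \<le> lam Y + lam Z"
    using lam_submod Y(1) Z(1) by meson
  have sub: "(A \<union> B) - J \<subseteq> M" "(A \<inter> B) - W \<subseteq> M" "Y \<inter> Z - W \<subseteq> M" "A - Y \<subseteq> M" "B - Z \<subseteq> M"
    using assms lattice_sub[OF Y(1)] by auto
  \<comment> \<open>No element is counted more often on the left. One in
    \<open>(A \<union> B) - J\<close> lies outside both \<open>Y\<close> and \<open>Z\<close>, so
    \<open>A - Y\<close> and \<open>B - Z\<close> count it once for each of \<open>A\<close> and
    \<open>B\<close> containing it, which covers the case that it is also in
    \<open>(A \<inter> B) - W\<close>. One that is only in \<open>(A \<inter> B) - W\<close> misses
    \<open>Y\<close>, misses \<open>Z\<close>, or lies in \<open>Y \<inter> Z - W\<close>.\<close>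
  have "\<mu> ((A \<union> B) - J) + \<mu> ((A \<inter> B) - W) \<le> \<mu> (Y \<inter> Z - W) + \<mu> (A - Y) + \<mu> (B - Z)"
    unfolding measure_eq_sum[OF sub(1)] measure_eq_sum[OF sub(2)] measure_eq_sum[OF sub(3)]
      measure_eq_sum[OF sub(4)] measure_eq_sum[OF sub(5)] sum.distrib[symmetric]
    using JW(3,4) singleton_nonneg by (intro sum_mono) auto
  then show ?thesis
    using submod Y(2) Z(2) r_le[OF JW(1), of "A \<union> B"] r_le[OF JW(2), of "A \<inter> B"] by linarith
qed

lemma polymatroid_r: "polymatroid r M"
  using finite_ground r_nonneg r_mono r_submodular by (simp add: polymatroid_def)

section \<open>Values on the lattice and on singletons\<close>

lemma lam_less:
  assumes "Z \<in> \<L>" "Y \<in> \<L>" "Y \<noteq> Z"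
  shows "lam Z < lam Y + \<mu> (Z - Y)"
proof -
  obtain J W where JW: "J \<in> \<L>" "W \<in> \<L>" "Y \<union> Z \<subseteq> J" "W \<subseteq> Y \<inter> Z"
      and submod: "lam J + lam W + \<mu> (Y \<inter> Z - W) \<le> lam Y + lam Z"
    using lam_submod assms(1,2) by meson
  \<comment> \<open>With this splitting, adding \<open>\<mu> (Z - Y)\<close> to both sides of
    \<open>submod\<close> gives \<open>lam J + lam W + \<mu> (Z - W) \<le> lam Y + \<mu> (Z - Y) +
    lam Z\<close>. It remains to bound the left side below by twice \<open>lam Z\<close>,
    strictly.\<close>
  have split: "\<mu> (Z - W) = \<mu> (Z - Y) + \<mu> (Y \<inter> Z - W)"
  proof -
    have "Z - W = (Z - Y) \<union> (Y \<inter> Z - W)" using JW(4) by blast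
    moreover have "\<mu> ((Z - Y) \<union> (Y \<inter> Z - W)) = \<mu> (Z - Y) + \<mu> (Y \<inter> Z - W)"
      using lattice_sub[OF assms(1)] by (intro measure_union) auto
    ultimately show ?thesis by simp
  qed
  have J: "lam Z \<le> lam J" "J \<noteq> Z \<Longrightarrow> lam Z < lam J"
    using lam_strict[OF assms(1) JW(1)] JW(3) by (cases "J = Z"; auto)+
  have W: "lam Z \<le> lam W + \<mu> (Z - W)" "W \<noteq> Z \<Longrightarrow> lam Z < lam W + \<mu> (Z - W)"
    using lam_strict[OF JW(2) assms(1)] JW(4) by (cases "W = Z"; force)+
  \<comment> \<open>If both were equal to \<open>Z\<close>, then
    \<open>Y \<subseteq> J = Z = W \<subseteq> Y\<close>. Hence at least one of the two bounds is
    strict.\<close>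
  have "J \<noteq> Z \<or> W \<noteq> Z"
    using JW(3,4) assms(3) by blast
  then show ?thesis
    using J W split submod by fastforce
qed

lemma r_lattice:
  assumes "Z \<in> \<L>"
  shows "r Z = lam Z"
proof (rule antisym)
  show "r Z \<le> lam Z" using r_le[OF assms, of Z] by simp
  obtain Y where "Y \<in> \<L>" "r Z = lam Y + \<mu> (Z - Y)" by (rule r_attained)
  then show "lam Z \<le> r Z"
    using lam_less[OF assms, of Y] by (cases "Y = Z") auto
qed

text \<open>The candidate \<open>bot\<close>, of rank zero, gives the upper bound. For the lower
  bound, a minimizer containing \<open>a\<close> has rank at least \<open>\<mu> {a}\<close> by
  \<open>measure_le_lam\<close>, while one missing \<open>a\<close> pays \<open>\<mu> {a}\<close> in
  the measure term.\<close>

lemma r_singleton: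
  assumes "a \<in> M"
  shows "r {a} = \<mu> {a}"
proof (rule antisym)
  have "r {a} \<le> \<mu> ({a} - bot)"
    using r_le[OF bot_in, of "{a}"] lam_bot by simp
  also have "\<dots> \<le> \<mu> {a}"
    using assms by (intro measure_mono) auto
  finally show "r {a} \<le> \<mu> {a}" .
  obtain Y where Y: "Y \<in> \<L>" "r {a} = lam Y + \<mu> ({a} - Y)" by (rule r_attained)
  show "\<mu> {a} \<le> r {a}"
  proof (cases "a \<in> Y")
    case True
    then have "{a} - Y = {}" by blast
    then show ?thesis using Y(2) measure_le_lam[OF True Y(1)] by simp
  next
    case False
    then have "{a} - Y = {a}" by blast
    then show ?thesis using Y(2) lam_nonneg[OF Y(1)] by simp
  qed
qed

section \<open>Cyclic flats are exactly the lattice members\<close>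

lemma lattice_flat:
  assumes "Z \<in> \<L>"
  shows "flat r M Z"
  unfolding flat_def
proof (intro conjI allI impI)
  show "Z \<subseteq> M" using lattice_sub[OF assms] .
  fix F assume F: "Z \<subset> F \<and> F \<subseteq> M"
  obtain Y where Y: "Y \<in> \<L>" "r F = lam Y + \<mu> (F - Y)" by (rule r_attained)
  show "r Z < r F"
  \<comment> \<open>If \<open>Z\<close> itself is the chosen minimizer for \<open>F\<close>, the
    increase comes from an element of \<open>F - Z\<close>, which has positive measure because
    \<open>bot \<subseteq> Z\<close>. Any other \<open>Y\<close> already costs more than
    \<open>lam Z\<close> on \<open>Z\<close> alone.\<close>
  proof (cases "Y = Z")
    case True
    obtain a where a: "a \<in> F - Z" using F by blast
    then have "0 < \<mu> {a}" using measure_pos bot_sub[OF assms] F by blast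
    also have "\<dots> \<le> \<mu> (F - Z)" using a F by (intro measure_ge_singleton) auto
    finally show ?thesis using Y(2) True r_lattice[OF assms] by simp
  next
    case False
    have "\<mu> (Z - Y) \<le> \<mu> (F - Y)" using F by (intro measure_mono) auto
    then show ?thesis
      using lam_less[OF assms Y(1) False] Y(2) r_lattice[OF assms] by simp
  qed
qed

lemma lattice_cyclic_flat:
  assumes "Z \<in> \<L>"
  shows "cyclic_flat r M Z"
  unfolding cyclic_flat_def
proof (intro conjI ballI lattice_flat[OF assms])
  fix i assume i: "i \<in> Z"
  have ZM: "Z \<subseteq> M" using lattice_sub[OF assms] .
  then have iM: "i \<in> M" using i by blast
  obtain Y where Y: "Y \<in> \<L>" "r (Z - {i}) = lam Y + \<mu> ((Z - {i}) - Y)" by (rule r_attained)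
  \<comment> \<open>Measure zero is the alternative \<open>r {i} = 0\<close> of cyclicity. Otherwise
    either \<open>Z\<close> is still the minimizer and the rank does not drop, or another
    \<open>Y\<close> is; its cost on \<open>Z\<close> strictly exceeds \<open>lam Z\<close> and
    falls by at most \<open>\<mu> {i}\<close> when \<open>i\<close> is removed.\<close>
  have "lam Z - r (Z - {i}) < \<mu> {i}" if pos: "0 < \<mu> {i}"
  proof (cases "Y = Z")
    case True
    then have "(Z - {i}) - Y = {}" by blast
    then have "r (Z - {i}) = lam Y" using Y(2) by (simp only: measure_empty add_0_right)
    then have "r (Z - {i}) = lam Z" using True by simp
    then show ?thesis using pos by simp
  next
    case False
    have "\<mu> (Z - Y) - \<mu> {i} \<le> \<mu> ((Z - {i}) - Y)"
    proof (cases "i \<in> Y")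
      case True
      then have "(Z - {i}) - Y = Z - Y" by blast
      then show ?thesis using pos by simp
    next
      case False
      have "(Z - {i}) - Y = (Z - Y) - {i}" by blast
      moreover have "\<mu> ((Z - Y) - {i}) = \<mu> (Z - Y) - \<mu> {i}"
        using ZM i False by (intro measure_remove) auto
      ultimately show ?thesis by simp
    qed
    then show ?thesis using lam_less[OF assms Y(1) False] Y(2) by simp
  qed
  then show "r {i} = 0 \<or> r Z - r (Z - {i}) < r {i}"
    using singleton_nonneg[OF iM] r_singleton[OF iM] r_lattice[OF assms] by linarith
qed

lemma cyclic_flat_lattice:
  assumes "cyclic_flat r M C"
  shows "C \<in> \<L>"
proof -
  have CM: "C \<subseteq> M" and flat: "\<And>F. C \<subset> F \<Longrightarrow> F \<subseteq> M \<Longrightarrow> r C < r F"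
      and cyc: "\<And>i. i \<in> C \<Longrightarrow> r {i} = 0 \<or> r C - r (C - {i}) < r {i}"
    using assms by (auto simp: cyclic_flat_def flat_def)
  obtain Y where Y: "Y \<in> \<L>" "r C = lam Y + \<mu> (C - Y)" by (rule r_attained)
  \<comment> \<open>Adjoining \<open>Y\<close> leaves the cost of the candidate \<open>Y\<close>
    unchanged, so a flat \<open>C\<close> must already contain it.\<close>
  have "r (C \<union> Y) \<le> r C"
    using r_le[OF Y(1), of "C \<union> Y"] Y(2) by (simp add: Un_Diff)
  then have "Y \<subseteq> C"
    using flat[of "C \<union> Y"] lattice_sub[OF Y(1)] CM by fastforce
  moreover have "i \<in> Y" if i: "i \<in> C" for i
  proof (rule ccontr)
    assume niY: "i \<notin> Y"
    have iM: "i \<in> M" using i CM by blast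
    have "0 < \<mu> {i}" using measure_pos bot_sub[OF Y(1)] niY iM by blast
    \<comment> \<open>The same \<open>Y\<close> is a candidate for \<open>C - {i}\<close>, and it no
      longer pays for \<open>i\<close>. So the rank drops by at least \<open>r {i} > 0\<close>, and
      both alternatives of cyclicity fail.\<close>
    moreover have "r (C - {i}) \<le> r C - \<mu> {i}"
    proof -
      have "(C - {i}) - Y = (C - Y) - {i}" by blast
      moreover have "\<mu> ((C - Y) - {i}) = \<mu> (C - Y) - \<mu> {i}"
        using CM i niY by (intro measure_remove) auto
      ultimately show ?thesis
        using r_le[OF Y(1), of "C - {i}"] Y(2) by simp
    qed
    ultimately show False using cyc[OF i] r_singleton[OF iM] by linarith
  qed
  ultimately have "C = Y" by blast
  then show ?thesis using Y(1) by simp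
qed

end

section \<open>The least element of a finite lattice\<close>

lemma finite_lattice_bottom:
  assumes "lattice (inclusion_order \<L>)" "finite \<L>" "\<L> \<noteq> {}"
  shows "\<bottom>\<^bsub>inclusion_order \<L>\<^esub> \<in> \<L>"
    and "Z \<in> \<L> \<Longrightarrow> \<bottom>\<^bsub>inclusion_order \<L>\<^esub> \<subseteq> Z"
proof -
  interpret lattice "inclusion_order \<L>" by fact
  obtain B where B: "B \<in> \<L>" "\<And>Z. Z \<in> \<L> \<Longrightarrow> Z \<subseteq> B \<Longrightarrow> Z = B"
    using finite_has_minimal[OF assms(2,3)] by metis
  \<comment> \<open>The meet of \<open>B\<close> and \<open>Z\<close> lies below the minimal
    \<open>B\<close>, hence equals it, so \<open>B\<close> lies below \<open>Z\<close>.\<close>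
  have "B \<subseteq> Z" if "Z \<in> \<L>" for Z
    using B(2)[of "B \<sqinter>\<^bsub>inclusion_order \<L>\<^esub> Z"] meet_closed[of B Z] meet_left[of B Z] meet_right[of B Z]
      B(1) that by simp
  then have "least (inclusion_order \<L>) B \<L>"
    using B(1) by (auto simp: least_def)
  \<comment> \<open>The bottom is a Hilbert choice among least elements, so it is meaningful once a
    least element such as \<open>B\<close> has been exhibited.\<close>
  then have "least (inclusion_order \<L>) \<bottom>\<^bsub>inclusion_order \<L>\<^esub> \<L>"
    unfolding bottom_def by (simp, rule someI)
  then show "\<bottom>\<^bsub>inclusion_order \<L>\<^esub> \<in> \<L>" "Z \<in> \<L> \<Longrightarrow> \<bottom>\<^bsub>inclusion_order \<L>\<^esub> \<subseteq> Z"
    by (auto simp: least_def)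
qed

theorem claim6:
  fixes M :: "'a set" and \<L> :: "'a set set"
    and lam :: "'a set \<Rightarrow> real" and \<mu> :: "'a set \<Rightarrow> real" and r :: "'a set \<Rightarrow> real"
  assumes "finite M"
    and "ranked_lattice lam \<L> M"
    and "measure_on \<mu> M"
    and "lam \<bottom>\<^bsub>inclusion_order \<L>\<^esub> = 0"
    and "\<And>Z1 Z2. Z1 \<in> \<L> \<Longrightarrow> Z2 \<in> \<L> \<Longrightarrow> Z1 \<subset> Z2 \<Longrightarrow>
           0 < lam Z2 - lam Z1 \<and> lam Z2 - lam Z1 < \<mu> (Z2 - Z1)"
    and "\<And>Z1 Z2. Z1 \<in> \<L> \<Longrightarrow> Z2 \<in> \<L> \<Longrightarrow>
           lam Z1 + lam Z2 \<ge> lam (Z1 \<squnion>\<^bsub>inclusion_order \<L>\<^esub> Z2) + lam (Z1 \<sqinter>\<^bsub>inclusion_order \<L>\<^esub> Z2)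
             + \<mu> ((Z1 \<inter> Z2) - (Z1 \<sqinter>\<^bsub>inclusion_order \<L>\<^esub> Z2))"
    and "\<And>a Z. a \<in> Z \<Longrightarrow> Z \<in> \<L> \<Longrightarrow> \<mu> {a} \<le> lam Z"
    and "\<And>Z. Z \<in> \<L> \<Longrightarrow> Z \<noteq> \<bottom>\<^bsub>inclusion_order \<L>\<^esub> \<Longrightarrow> lam Z > 0"
    and "\<And>a. a \<in> M - \<bottom>\<^bsub>inclusion_order \<L>\<^esub> \<Longrightarrow> \<mu> {a} > 0"
    and "r = convolution lam \<L> \<mu>"
  shows "polymatroid r M \<and>
         \<L> = {C. cyclic_flat r M C} \<and>
         (\<forall>Z\<in>\<L>. r Z = lam Z) \<and>
         (\<forall>a\<in>M. r {a} = \<mu> {a})"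
proof -
  let ?O = "inclusion_order \<L>"
  have lat: "lattice ?O" and ne: "\<L> \<noteq> {}" and pow: "\<L> \<subseteq> Pow M"
    and nonneg: "\<And>Z. Z \<in> \<L> \<Longrightarrow> 0 \<le> lam Z"
    using assms(2) by (auto simp: ranked_lattice_def)
  have fin: "finite \<L>"
    using pow assms(1) by (auto intro: finite_subset)
  interpret L: lattice ?O by (rule lat)
  interpret lattice_convolution M "\<bottom>\<^bsub>?O\<^esub>" \<L> lam \<mu>
  proof
    fix Z1 Z2 assume Z: "Z1 \<in> \<L>" "Z2 \<in> \<L>"
    let ?J = "Z1 \<squnion>\<^bsub>?O\<^esub> Z2" and ?W = "Z1 \<sqinter>\<^bsub>?O\<^esub> Z2"
    \<comment> \<open>The lattice join and meet are the witnesses for the existential form of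
      submodularity in the locale.\<close>
    have "?J \<in> \<L>" "?W \<in> \<L>" "Z1 \<union> Z2 \<subseteq> ?J" "?W \<subseteq> Z1 \<inter> Z2"
      using L.join_closed[of Z1 Z2] L.meet_closed[of Z1 Z2] L.join_left[of Z1 Z2]
        L.join_right[of Z1 Z2] L.meet_left[of Z1 Z2] L.meet_right[of Z1 Z2] Z by auto
    then show "\<exists>J\<in>\<L>. \<exists>W\<in>\<L>. Z1 \<union> Z2 \<subseteq> J \<and> W \<subseteq> Z1 \<inter> Z2 \<and>
        lam J + lam W + \<mu> (Z1 \<inter> Z2 - W) \<le> lam Z1 + lam Z2"
      using assms(6)[OF Z] by blast
  next
    fix Z1 Z2 assume "Z1 \<in> \<L>" "Z2 \<in> \<L>" "Z1 \<subset> Z2"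
    then show "lam Z1 < lam Z2 \<and> lam Z2 - lam Z1 < \<mu> (Z2 - Z1)"
      using assms(5)[of Z1 Z2] by simp
  qed (use assms(1,3,4,7,9) pow nonneg finite_lattice_bottom[OF lat fin ne] in auto)
  show ?thesis
    unfolding assms(10)
    using polymatroid_r lattice_cyclic_flat cyclic_flat_lattice r_lattice r_singleton by blast
qed

end
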